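(* For each integer $n\ge 3$, the cycle $C_n$ with $n$ vertices satisfies $$M(C_n)=\begin{cases}\dfrac{n^2-2n+4}{2} & \text{if } n\equiv 0\pmod 2,\\[2mm] n^2-n+1 & \text{otherwise.}\end{cases}$$
   Context: Graphs are finite, simple and undirected. For $n\ge3$, $C_n$ is the graph with vertex set $\{1,\dots,n\}$ and edge set $\{\{i,i+1\} : 1\le i\le n-1\}\cup\{\{1,n\}\}$. For a graph $\mathcal{G}$ with $n$ vertices and adjacency matrix $A$, viewed over $\mathbb{F}_2$, let $C(\mathcal{G})\subseteq\mathbb{F}_2^{2n}$ be the binary linear code generated by the rows of $[I_n|A]$, where $I_n$ is the $n\times n$ identity matrix. The support of a vector is the set of positions of its nonzero entries. A nonzero codeword $c$ of a binary linear code $C$ is minimal if there is no nonzero codeword $c'\in C$ with $\operatorname{supp}(c')\subsetneq\operatorname{supp}(c)$. $M(\mathcal{G})$ denotes the number of minimal codewords of $C(\mathcal{G})$; it does not depend on the labeling of the vertices. *)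

theory Defs
  imports "HOL-Library.Z2" "Jordan_Normal_Form.VS_Connect"
begin

type_synonym 'a ugraph = "'a set \<times> 'a set set"

definition simple_graph :: "'a ugraph \<Rightarrow> bool" where
  "simple_graph G \<longleftrightarrow> finite (fst G) \<and> (\<forall>e \<in> snd G. e \<subseteq> fst G \<and> card e = 2)"

definition cycle_graph :: "nat \<Rightarrow> nat ugraph" where
  "cycle_graph n = ({1..n}, {{i, i + 1} | i. 1 \<le> i \<and> i \<le> n - 1} \<union> {{1, n}})"

lemma simple_graph_cycle_graph:
  assumes "n \<ge> 3"
  shows "simple_graph (cycle_graph n)"
  using assms by (auto simp: simple_graph_def cycle_graph_def)

text \<open>Vertices are listed in increasing order, so for the vertex set \<open>{1..n}\<close> row and column
  \<open>i\<close> (counted from 0) belong to vertex \<open>i + 1\<close>. Diagonal entries are 0 in a simple graph, as a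
  singleton is not an edge.\<close>

definition adjacency_matrix :: "('a :: linorder) ugraph \<Rightarrow> bit mat" where
  "adjacency_matrix G =
     (let vs = sorted_list_of_set (fst G); n = card (fst G)
      in mat n n (\<lambda>(i, j). if {vs ! i, vs ! j} \<in> snd G then 1 else 0))"

text \<open>The matrix \<open>[I | A]\<close>: the two lower blocks have no rows.\<close>

definition code_generator_matrix :: "('a :: linorder) ugraph \<Rightarrow> bit mat" where
  "code_generator_matrix G =
     (let n = card (fst G)
      in four_block_mat (1\<^sub>m n) (adjacency_matrix G) (0\<^sub>m 0 n) (0\<^sub>m 0 n))"

definition graph_code :: "('a :: linorder) ugraph \<Rightarrow> bit vec set" where
  "graph_code G = vec_space.row_space (2 * card (fst G)) (code_generator_matrix G)"

definition vec_support :: "('b :: zero) vec \<Rightarrow> nat set" where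
  "vec_support v = {i. i < dim_vec v \<and> v $ i \<noteq> 0}"

definition minimal_codeword :: "('b :: zero) vec set \<Rightarrow> 'b vec \<Rightarrow> bool" where
  "minimal_codeword C c \<longleftrightarrow>
     c \<in> C \<and> c \<noteq> 0\<^sub>v (dim_vec c) \<and>
     \<not> (\<exists>c' \<in> C. c' \<noteq> 0\<^sub>v (dim_vec c') \<and> vec_support c' \<subset> vec_support c)"

definition num_minimal_codewords :: "('a :: linorder) ugraph \<Rightarrow> nat" where
  "num_minimal_codewords G = card {c. minimal_codeword (graph_code G) c}"

end

theory Submission
  imports Defs "HOL-Number_Theory.Cong"
begin

text \<open>
  Number the vertices of the cycle \<open>0, \<dots>, n - 1\<close>. The codewords are the vectors \<open>(x, A x)\<close>; let \<open>S\<close> be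
  the support of \<open>x\<close>. The entry of \<open>A x\<close> at the vertex \<open>v + 1\<close> is \<open>x\<^sub>v + x\<^sub>v\<^sub>+\<^sub>2\<close>, so it is nonzero iff \<open>S\<close>
  separates \<open>v\<close> from \<open>v + 2\<close> (all modulo \<open>n\<close>). In other words, let \<open>H\<close> be the graph (possibly with
  double edges) on the same vertices with one edge from \<open>v\<close> to \<open>v + 2\<close> for each \<open>v\<close>; then the support
  of the codeword is \<open>S\<close> together with a copy of the set of edges of \<open>H\<close> leaving \<open>S\<close>
  (\<open>support_codeword\<close>).

  Hence the codeword of \<open>S\<close> is minimal iff \<open>S\<close> is nonempty and no nonempty proper subset \<open>T\<close> of \<open>S\<close>
  has all its leaving edges among those of \<open>S\<close>, that is, iff \<open>S\<close> is connected in \<open>H\<close>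
  (\<open>minimal_codeword_iff\<close>).

  The graph \<open>H\<close> is a single cycle of length \<open>m = n\<close> if \<open>n\<close> is odd, and two disjoint cycles of length
  \<open>m = n / 2\<close> if \<open>n\<close> is even. Its connected sets are the arcs of consecutive vertices
  (\<open>step_connected_sets_eq\<close>). An arc of length \<open>k\<close> with \<open>1 \<le> k < m\<close> is determined by its first vertex
  and \<open>k\<close>, and there are \<open>n / m\<close> full cycles, which gives \<open>n (m - 1) + n / m\<close> minimal codewords
  (\<open>card_step_connected\<close>).
\<close>

section \<open>Connected sets of the graph joining v to v + 2 modulo n\<close>

text \<open>The \<open>k\<close> vertices visited first by the walk from \<open>a\<close> with steps of \<open>2\<close>. The vertices need not be
  distinct: repetitions occur when \<open>k\<close> exceeds the length of the cycle that contains \<open>a\<close>.\<close>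

definition arc :: "nat \<Rightarrow> nat \<Rightarrow> nat \<Rightarrow> nat set" where
  "arc n a k = (\<lambda>i. (a + 2 * i) mod n) ` {..<k}"

text \<open>The edges from \<open>v\<close> to \<open>v + 2\<close> with exactly one end in \<open>S\<close>, each represented by \<open>v\<close>. Since \<open>v\<close>
  serves as the name of the edge, the two parallel edges between \<open>v\<close> and \<open>v + 2\<close> for \<open>n = 4\<close> are
  told apart.\<close>

definition step_cut :: "nat \<Rightarrow> nat set \<Rightarrow> nat set" where
  "step_cut n S = {v. v < n \<and> (v \<in> S) \<noteq> ((v + 2) mod n \<in> S)}"

text \<open>Connectedness in the form in which it comes out of minimality of codewords: for \<open>T \<subseteq> S\<close>, the
  inclusion of the cuts says that no edge inside \<open>S\<close> leaves \<open>T\<close>, so that \<open>T\<close> is a union of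
  components of \<open>S\<close>.\<close>

definition step_connected :: "nat \<Rightarrow> nat set \<Rightarrow> bool" where
  "step_connected n S \<longleftrightarrow> S \<subseteq> {..<n} \<and> S \<noteq> {} \<and>
     (\<forall>T \<subseteq> S. T \<noteq> {} \<longrightarrow> step_cut n T \<subseteq> step_cut n S \<longrightarrow> T = S)"

text \<open>The length of each cycle formed by the steps of \<open>2\<close> modulo \<open>n\<close>.\<close>

definition period :: "nat \<Rightarrow> nat" where
  "period n = (if even n then n div 2 else n)"

lemma period_pos: "n > 0 \<Longrightarrow> period n > 0"
  by (auto simp: period_def elim!: evenE)

lemma walk_eq_iff:
  assumes "n > 0"
  shows "(a + 2 * i) mod n = (a + 2 * j) mod n \<longleftrightarrow> i mod period n = j mod period n"
proof -
  have "(a + 2 * i) mod n = (a + 2 * j) mod n \<longleftrightarrow> [2 * i = 2 * j] (mod n)"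
    by (metis cong_add_lcancel_nat cong_def)
  also have "\<dots> \<longleftrightarrow> [i = j] (mod period n)"
  proof (cases "even n")
    case True
    then obtain m where "n = 2 * m" by blast
    then show ?thesis
      by (simp add: cong_def period_def flip: mult_mod_right)
  next
    case False
    then show ?thesis
      by (simp add: period_def cong_mult_lcancel_nat)
  qed
  finally show ?thesis by (simp add: cong_def)
qed

lemma walk_step: "((a + 2 * i) mod n + 2) mod n = (a + 2 * Suc i) mod n"
  by (simp add: mod_simps)

lemma walk_inj:
  assumes "n > 0" "(a + 2 * i) mod n = (a + 2 * j) mod n" "i < period n" "j < period n"
  shows "i = j"
  using assms by (simp add: walk_eq_iff)

lemma walk_cycle: "n > 0 \<Longrightarrow> (a + 2 * period n) mod n = a mod n"
  using walk_eq_iff[of n a "period n" 0] by simp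

lemma arc_subset: "n > 0 \<Longrightarrow> arc n a k \<subseteq> {..<n}"
  by (auto simp: arc_def)

lemma card_arc: "n > 0 \<Longrightarrow> k \<le> period n \<Longrightarrow> card (arc n a k) = k"
  unfolding arc_def
  by (subst card_image) (auto intro!: inj_onI dest: walk_inj)

lemma step_inj:
  fixes v w n :: nat
  assumes "v < n" "w < n" "(v + 2) mod n = (w + 2) mod n"
  shows "v = w"
proof -
  have "[v + 2 = w + 2] (mod n)" using assms(3) by (simp only: cong_def)
  then have "[v = w] (mod n)" by (simp only: cong_add_rcancel_nat)
  then show ?thesis using assms(1,2) by (simp add: cong_def)
qed

lemma step_connected_arc:
  assumes n: "n > 0" and k: "0 < k" "k \<le> period n"
  shows "step_connected n (arc n a k)"
  unfolding step_connected_def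
proof (intro conjI allI impI)
  show "arc n a k \<subseteq> {..<n}" using arc_subset[OF n] .
  show "arc n a k \<noteq> {}" using k by (auto simp: arc_def)
  fix T assume T: "T \<subseteq> arc n a k" "T \<noteq> {}" "step_cut n T \<subseteq> step_cut n (arc n a k)"
  have in_arc: "(a + 2 * i) mod n \<in> arc n a k" if "i < k" for i
    using that by (auto simp: arc_def)
  have same: "(a + 2 * i) mod n \<in> T \<longleftrightarrow> (a + 2 * Suc i) mod n \<in> T" if "Suc i < k" for i
  proof -
    let ?v = "(a + 2 * i) mod n"
    have step: "(?v + 2) mod n = (a + 2 * Suc i) mod n" by (rule walk_step)
    have "?v \<in> arc n a k" "(?v + 2) mod n \<in> arc n a k"
      using in_arc[of i] in_arc[of "Suc i"] that by (simp_all only: step)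
    then have "?v \<notin> step_cut n (arc n a k)" unfolding step_cut_def by blast
    then have "?v \<notin> step_cut n T" using T(3) by blast
    then have "?v \<in> T \<longleftrightarrow> (?v + 2) mod n \<in> T" using n by (simp add: step_cut_def)
    then show ?thesis by (simp only: step)
  qed
  have same0: "(a + 2 * i) mod n \<in> T \<longleftrightarrow> (a + 2 * 0) mod n \<in> T" if "i < k" for i
    using that
  proof (induction i)
    case (Suc i)
    then show ?case using same[of i] by (metis Suc_lessD)
  qed simp
  obtain i where "i < k" "(a + 2 * i) mod n \<in> T"
    using T(1,2) by (auto simp: arc_def)
  then have "arc n a k \<subseteq> T"
    using same0 by (auto simp: arc_def)
  with T(1) show "T = arc n a k" by blast
qed

text \<open>A connected set containing a whole cycle equals that cycle. Any other one has a first vertex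
  \<open>a\<close>, one whose predecessor lies outside; the longest arc from \<open>a\<close> inside the set is a component.\<close>

lemma arc_if_step_connected:
  assumes n: "n > 0" and S: "step_connected n S"
  obtains a k where "a < n" "0 < k" "k \<le> period n" "S = arc n a k"
proof -
  let ?w = "\<lambda>b i. (b + 2 * i) mod n"
  let ?m = "period n"
  have sub: "S \<subseteq> {..<n}" and min: "\<And>T. T \<subseteq> S \<Longrightarrow> T \<noteq> {} \<Longrightarrow> step_cut n T \<subseteq> step_cut n S \<Longrightarrow> T = S"
    using S by (auto simp: step_connected_def)
  have m: "?m > 0" using period_pos[OF n] .
  obtain b where b: "b \<in> S" using S by (auto simp: step_connected_def)
  then have bn: "b < n" using sub by auto
  show ?thesis
  proof (cases "\<forall>i. ?w b i \<in> S")
    case True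
    have closed: "v \<in> arc n b ?m \<longleftrightarrow> (v + 2) mod n \<in> arc n b ?m" if "v < n" for v
    proof -
      have all: "?w b i \<in> arc n b ?m" for i
      proof -
        have "?w b i = ?w b (i mod ?m)" using walk_eq_iff[OF n] by simp
        then show ?thesis using m by (auto simp: arc_def)
      qed
      show ?thesis
      proof
        assume "v \<in> arc n b ?m"
        then obtain i where "v = ?w b i" by (auto simp: arc_def)
        then show "(v + 2) mod n \<in> arc n b ?m"
          using all[of "Suc i"] by (simp only: walk_step)
      next
        assume "(v + 2) mod n \<in> arc n b ?m"
        then obtain i where "(v + 2) mod n = ?w b i" by (auto simp: arc_def)
        also have "\<dots> = ?w b (Suc (i + ?m - 1))"
          using walk_eq_iff[OF n, of b i "i + ?m"] m by simp
        also have "\<dots> = (?w b (i + ?m - 1) + 2) mod n"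
          by (simp only: walk_step)
        finally have "v = ?w b (i + ?m - 1)"
          using that n by (intro step_inj[of v n]) auto
        then show "v \<in> arc n b ?m" using all by simp
      qed
    qed
    have "arc n b ?m = S"
    proof (rule min)
      show "arc n b ?m \<subseteq> S" using True by (auto simp: arc_def)
      show "arc n b ?m \<noteq> {}" using m by (auto simp: arc_def)
      show "step_cut n (arc n b ?m) \<subseteq> step_cut n S"
        using closed by (auto simp: step_cut_def)
    qed
    then show ?thesis using that[of b ?m] bn m by simp
  next
    case False
    then obtain j where j: "?w b j \<notin> S" by blast
    \<comment> \<open>If no vertex outside precedes one inside, then the walk from the vertex outside never returns
      to \<open>S\<close>, although it passes through \<open>b\<close>.\<close>
    have "\<exists>c. c < n \<and> c \<notin> S \<and> (c + 2) mod n \<in> S"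
    proof (rule ccontr)
      assume no: "\<not> ?thesis"
      have "?w b (j + i) \<notin> S" for i
      proof (induction i)
        case 0 then show ?case using j by simp
      next
        case (Suc i)
        then have "(?w b (j + i) + 2) mod n \<notin> S" using no n by (meson mod_less_divisor)
        then show ?case by (simp only: walk_step add_Suc_right not_False_eq_True)
      qed
      \<comment> \<open>After a multiple of the period the walk is back at \<open>b\<close>.\<close>
      from this[of "j * ?m - j"] have "?w b (j * ?m) \<notin> S" using m by simp
      moreover have "?w b (j * ?m) = ?w b 0" by (subst walk_eq_iff[OF n]) simp
      ultimately show False using b bn by simp
    qed
    then obtain c where c: "c < n" "c \<notin> S" "(c + 2) mod n \<in> S" by blast
    define a where "a = (c + 2) mod n"
    have a: "a < n" "a \<in> S" using c n by (auto simp: a_def)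
    have wa: "?w a i = ?w c (Suc i)" for i by (simp add: a_def mod_simps)
    have last: "?w a (?m - 1) \<notin> S"
      using c m walk_cycle[OF n, of c] by (simp add: wa del: mult_Suc_right)
    define k where "k = (LEAST i. ?w a i \<notin> S)"
    have k_out: "?w a k \<notin> S" unfolding k_def by (rule LeastI[of _ "?m - 1"]) (rule last)
    have k_in: "?w a i \<in> S" if "i < k" for i using not_less_Least[OF that[unfolded k_def]] by blast
    have "k \<le> ?m - 1" unfolding k_def by (rule Least_le) (rule last)
    with m have k_le: "k \<le> ?m" by simp
    have k0: "k > 0" using k_out a by (cases k) auto
    have "arc n a k = S"
    proof (rule min)
      show "arc n a k \<subseteq> S" using k_in by (auto simp: arc_def)
      show "arc n a k \<noteq> {}" using k0 by (auto simp: arc_def)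
      show "step_cut n (arc n a k) \<subseteq> step_cut n S"
      proof
        fix v assume v: "v \<in> step_cut n (arc n a k)"
        then have vn: "v < n" by (simp add: step_cut_def)
        show "v \<in> step_cut n S"
        proof (cases "v \<in> arc n a k")
          case True
          then obtain i where i: "i < k" "v = ?w a i" by (auto simp: arc_def)
          then have step: "(v + 2) mod n = ?w a (Suc i)" by (simp only: walk_step)
          with v True have "?w a (Suc i) \<notin> arc n a k" by (simp add: step_cut_def)
          then have "\<not> Suc i < k" unfolding arc_def by blast
          with i have "Suc i = k" by simp
          then show ?thesis using k_out k_in[OF i(1)] i step vn by (simp add: step_cut_def del: mult_Suc_right)
        next
          case False
          with v obtain i where i: "i < k" "(v + 2) mod n = ?w a i"
            by (auto simp: arc_def step_cut_def)
          have "i = 0"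
          proof (rule ccontr)
            assume "i \<noteq> 0"
            then obtain i' where i': "i = Suc i'" by (cases i) auto
            then have "(v + 2) mod n = (?w a i' + 2) mod n" using i by (simp only: walk_step)
            then have "v = ?w a i'" using vn n by (intro step_inj[of v n]) auto
            then show False using False i i' by (auto simp: arc_def)
          qed
          then have "(v + 2) mod n = (c + 2) mod n" using i by (simp add: a_def)
          then have "v = c" using vn c by (intro step_inj[of v n])
          then show ?thesis using c by (simp add: step_cut_def)
        qed
      qed
    qed
    then show ?thesis using that[of a k] a k0 k_le by simp
  qed
qed

text \<open>The first vertex of an arc that is not a full cycle is the only one whose predecessor is not on
  the arc, hence the strict bound on \<open>k\<close>.\<close>

lemma arc_inj:
  assumes n: "n > 0" and ab: "a < n" "b < n" and k: "0 < k" "k < period n"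
    and eq: "arc n a k = arc n b k"
  shows "a = b"
proof (rule ccontr)
  assume "a \<noteq> b"
  have mem: "x mod n \<in> arc n x k" for x using k by (force simp: arc_def)
  obtain i where i: "i < k" "a = (b + 2 * i) mod n"
    using mem[of a] eq ab by (auto simp: arc_def)
  have "i \<noteq> 0" using i ab \<open>a \<noteq> b\<close> by (cases i) auto
  then obtain i' where i': "i = Suc i'" by (cases i) auto
  have "(b + 2 * i') mod n \<in> arc n a k" using i i' eq by (auto simp: arc_def)
  then obtain j where j: "j < k" "(b + 2 * i') mod n = (a + 2 * j) mod n"
    by (auto simp: arc_def)
  \<comment> \<open>The predecessor of \<open>a\<close> lies on the arc starting at \<open>a\<close>, so that the walk returns to \<open>a\<close> after
    at most \<open>k\<close> steps, fewer than the period.\<close>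
  have "(a + 2 * 0) mod n = a" using ab by simp
  also have "\<dots> = ((b + 2 * i') mod n + 2) mod n" using i i' by (simp only: walk_step)
  also have "\<dots> = (a + 2 * Suc j) mod n" using j by (simp only: walk_step)
  finally have "0 = Suc j" using walk_inj[OF n, of a 0 "Suc j"] j k by simp
  then show False by simp
qed

lemma full_arc_even:
  assumes "n = 2 * m" "n > 0"
  shows "arc n a m = {v. v < n \<and> v mod 2 = a mod 2}"
proof (rule card_subset_eq)
  have "(a + 2 * i) mod n mod 2 = a mod 2" for i
    using assms by (simp add: mod_mod_cancel)
  then show "arc n a m \<subseteq> {v. v < n \<and> v mod 2 = a mod 2}"
    using assms by (auto simp: arc_def)
  have "{v. v < n \<and> v mod 2 = a mod 2} = (\<lambda>i. 2 * i + a mod 2) ` {..<m}"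
  proof (intro equalityI subsetI)
    fix v assume "v \<in> {v. v < n \<and> v mod 2 = a mod 2}"
    then show "v \<in> (\<lambda>i. 2 * i + a mod 2) ` {..<m}"
      using assms div_mult_mod_eq[of v 2] by (intro image_eqI[of _ _ "v div 2"]) auto
  qed (use assms in auto)
  then have "card {v. v < n \<and> v mod 2 = a mod 2} = m"
    by (simp add: card_image inj_on_def)
  then show "card (arc n a m) = card {v. v < n \<and> v mod 2 = a mod 2}"
    using assms card_arc[of n m a] by (simp add: period_def)
qed simp

lemma full_arc_odd:
  assumes "odd n"
  shows "arc n a n = {..<n}"
  using assms arc_subset[of n a n] card_arc[of n n a]
  by (intro card_subset_eq) (auto simp: period_def odd_pos)

lemma card_full_arcs:
  assumes "n > 0"
  shows "card ((\<lambda>a. arc n a (period n)) ` {..<n}) = (if even n then 2 else 1)"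
proof (cases "even n")
  case True
  then obtain m where m: "n = 2 * m" by blast
  have "(\<lambda>a. arc n a (period n)) ` {..<n} = (\<lambda>r. {v. v < n \<and> v mod 2 = r}) ` {0, 1}"
  proof (intro equalityI subsetI)
    fix A assume "A \<in> (\<lambda>a. arc n a (period n)) ` {..<n}"
    then obtain a where "A = arc n a (period n)" by blast
    then have "A = {v. v < n \<and> v mod 2 = a mod 2}"
      using full_arc_even[OF m assms, of a] m by (simp add: period_def)
    moreover have "a mod 2 \<in> {0, 1}" by auto
    ultimately show "A \<in> (\<lambda>r. {v. v < n \<and> v mod 2 = r}) ` {0, 1}" by (rule image_eqI)
  next
    fix A assume "A \<in> (\<lambda>r. {v. v < n \<and> v mod 2 = r}) ` {0, 1}"
    then obtain r where r: "r \<in> {0, 1}" "A = {v. v < n \<and> v mod 2 = r}" by blast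
    have "r < n" using r(1) m assms by auto
    moreover have "r mod 2 = r" using r(1) by auto
    then have "A = arc n r (period n)"
      using full_arc_even[OF m assms, of r] r(2) m by (simp add: period_def)
    ultimately show "A \<in> (\<lambda>a. arc n a (period n)) ` {..<n}" by blast
  qed
  moreover have "inj_on (\<lambda>r. {v. v < n \<and> v mod 2 = r}) {0, 1}"
  proof (rule inj_onI)
    fix r s :: nat
    assume *: "r \<in> {0, 1}" "s \<in> {0, 1}" "{v. v < n \<and> v mod 2 = r} = {v. v < n \<and> v mod 2 = s}"
    have "r \<in> {v. v < n \<and> v mod 2 = r}" using *(1) m assms by auto
    then have "r mod 2 = s" unfolding *(3) by blast
    then show "r = s" using *(1) by auto
  qed
  ultimately show ?thesis using True by (simp add: card_image)
next
  case False
  then have "(\<lambda>a. arc n a (period n)) ` {..<n} = {{..<n}}"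
    using assms by (auto simp: period_def full_arc_odd)
  with False show ?thesis by simp
qed

lemma inj_on_proper_arcs:
  assumes n: "n > 0"
  shows "inj_on (\<lambda>(a, k). arc n a k) ({..<n} \<times> {1..<period n})"
proof (rule inj_onI)
  fix x y assume x: "x \<in> {..<n} \<times> {1..<period n}" and y: "y \<in> {..<n} \<times> {1..<period n}"
    and eq: "(case x of (a, k) \<Rightarrow> arc n a k) = (case y of (a, k) \<Rightarrow> arc n a k)"
  obtain a k where ak: "x = (a, k)" "a < n" "0 < k" "k < period n" using x by auto
  obtain b l where bl: "y = (b, l)" "b < n" "0 < l" "l < period n" using y by auto
  have arcs: "arc n a k = arc n b l" using eq ak(1) bl(1) by simp
  have card: "card (arc n a k) = k" if "k \<le> period n" for a k
    by (rule card_arc[OF n that])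
  have "k = card (arc n a k)" using ak(4) by (simp add: card)
  also have "\<dots> = l" unfolding arcs using bl(4) by (simp add: card)
  finally have "k = l" .
  have "arc n a k = arc n b k" using arcs by (simp only: \<open>k = l\<close>)
  then have "a = b" by (rule arc_inj[OF n ak(2) bl(2) ak(3,4)])
  then show "x = y" using ak(1) bl(1) \<open>k = l\<close> by simp
qed

lemma step_connected_sets_eq:
  assumes n: "n > 0"
  shows "{S. step_connected n S} =
    (\<lambda>(a, k). arc n a k) ` ({..<n} \<times> {1..<period n}) \<union> (\<lambda>a. arc n a (period n)) ` {..<n}"
proof (intro equalityI subsetI)
  fix S assume "S \<in> {S. step_connected n S}"
  then obtain a k where ak: "a < n" "0 < k" "k \<le> period n" "S = arc n a k"
    by (auto elim: arc_if_step_connected[OF n])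
  then show "S \<in> (\<lambda>(a, k). arc n a k) ` ({..<n} \<times> {1..<period n}) \<union>
      (\<lambda>a. arc n a (period n)) ` {..<n}"
    by (cases "k = period n") force+
next
  fix S assume "S \<in> (\<lambda>(a, k). arc n a k) ` ({..<n} \<times> {1..<period n}) \<union>
      (\<lambda>a. arc n a (period n)) ` {..<n}"
  then show "S \<in> {S. step_connected n S}"
    using step_connected_arc[OF n] period_pos[OF n] by auto
qed

lemma proper_arcs_disjoint_full_arcs:
  assumes n: "n > 0"
  shows "(\<lambda>(a, k). arc n a k) ` ({..<n} \<times> {1..<period n}) \<inter>
    (\<lambda>a. arc n a (period n)) ` {..<n} = {}"
proof -
  have card: "card (arc n a k) = k" if "k \<le> period n" for a k
    by (rule card_arc[OF n that])
  have less: "card S < period n" if "S \<in> (\<lambda>(a, k). arc n a k) ` ({..<n} \<times> {1..<period n})" for S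
    using that by (auto simp: card)
  have eq: "card S = period n" if "S \<in> (\<lambda>a. arc n a (period n)) ` {..<n}" for S
    using that by (auto simp: card)
  show ?thesis
  proof (rule Int_emptyI)
    fix S assume "S \<in> (\<lambda>(a, k). arc n a k) ` ({..<n} \<times> {1..<period n})"
      and "S \<in> (\<lambda>a. arc n a (period n)) ` {..<n}"
    then show False using less[of S] eq[of S] by simp
  qed
qed

lemma card_step_connected:
  assumes n: "n > 0"
  shows "card {S. step_connected n S} = n * (period n - 1) + (if even n then 2 else 1)"
proof -
  let ?A = "(\<lambda>(a, k). arc n a k) ` ({..<n} \<times> {1..<period n})"
  let ?F = "(\<lambda>a. arc n a (period n)) ` {..<n}"
  have sets: "{S. step_connected n S} = ?A \<union> ?F" by (rule step_connected_sets_eq[OF n])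
  have disj: "?A \<inter> ?F = {}" by (rule proper_arcs_disjoint_full_arcs[OF n])
  have inj: "inj_on (\<lambda>(a, k). arc n a k) ({..<n} \<times> {1..<period n})"
    by (rule inj_on_proper_arcs[OF n])
  have full: "card ?F = (if even n then 2 else 1)" by (rule card_full_arcs[OF n])
  have "card ?A = n * (period n - 1)" unfolding card_image[OF inj] by simp
  moreover have "card (?A \<union> ?F) = card ?A + card ?F" by (rule card_Un_disjoint[OF _ _ disj]) simp_all
  ultimately show ?thesis unfolding sets full by simp
qed

section \<open>The code of the cycle\<close>

text \<open>The codeword \<open>(x, A x)\<close> where \<open>x\<close> has support \<open>S\<close>. The index \<open>j = n + k\<close> in the second half
  belongs to the vertex \<open>k\<close>, and as \<open>j\<close> is congruent to \<open>k\<close> modulo \<open>n\<close>, the neighbours of \<open>k\<close> are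
  \<open>(j - 1) mod n\<close> and \<open>(j + 1) mod n\<close>; the subtraction does not truncate because \<open>j > 0\<close>.\<close>

definition codeword :: "nat \<Rightarrow> nat set \<Rightarrow> bit vec" where
  "codeword n S = vec (2 * n) (\<lambda>j. of_bool
     (if j < n then j \<in> S else ((j - 1) mod n \<in> S) \<noteq> ((j + 1) mod n \<in> S)))"

lemma dim_codeword [simp]: "dim_vec (codeword n S) = 2 * n"
  by (simp add: codeword_def)

text \<open>The vertices of \<open>cycle_graph n\<close> start at \<open>1\<close>, those used here at \<open>0\<close>. The summand \<open>n\<close> makes the
  right-hand side match the column index \<open>n + k\<close> and keeps the subtraction from truncating.\<close>

lemma cycle_edge_iff:
  assumes "n \<ge> 3" "i < n" "k < n"
  shows "{i + 1, k + 1} \<in> snd (cycle_graph n) \<longleftrightarrow> i = (n + k - 1) mod n \<or> i = (n + k + 1) mod n"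
proof -
  have edge: "{i + 1, k + 1} \<in> snd (cycle_graph n) \<longleftrightarrow>
      k = i + 1 \<or> i = k + 1 \<or> (i = 0 \<and> k = n - 1) \<or> (i = n - 1 \<and> k = 0)"
  proof -
    have "(\<exists>j. {i + 1, k + 1} = {j, j + 1} \<and> 1 \<le> j \<and> j \<le> n - 1) \<longleftrightarrow> k = i + 1 \<or> i = k + 1"
    proof
      assume "\<exists>j. {i + 1, k + 1} = {j, j + 1} \<and> 1 \<le> j \<and> j \<le> n - 1"
      then obtain j where "{i + 1, k + 1} = {j, j + 1}" by blast
      then show "k = i + 1 \<or> i = k + 1" unfolding doubleton_eq_iff by linarith
    next
      assume "k = i + 1 \<or> i = k + 1"
      then show "\<exists>j. {i + 1, k + 1} = {j, j + 1} \<and> 1 \<le> j \<and> j \<le> n - 1"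
      proof
        assume "k = i + 1"
        then show ?thesis using assms by (intro exI[of _ "i + 1"]) simp
      next
        assume "i = k + 1"
        then show ?thesis using assms by (intro exI[of _ "k + 1"]) (simp add: insert_commute)
      qed
    qed
    moreover have "{i + 1, k + 1} = {1, n} \<longleftrightarrow> (i = 0 \<and> k = n - 1) \<or> (i = n - 1 \<and> k = 0)"
      using assms unfolding doubleton_eq_iff by linarith
    ultimately show ?thesis by (simp add: cycle_graph_def) blast
  qed
  have pred: "(n + k - 1) mod n = (if k = 0 then n - 1 else k - 1)"
  proof (cases "k = 0")
    case False
    then have "n + k - 1 = n + (k - 1)" by simp
    then show ?thesis using False assms by (simp del: add_diff_assoc add_diff_assoc2)
  qed (use assms in simp)
  have succ: "(n + k + 1) mod n = (if k = n - 1 then 0 else k + 1)"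
    using assms mod_add_self1[of n "k + 1"] by (auto simp: add.assoc simp del: mod_add_self1)
  show ?thesis unfolding edge pred succ using assms
    by (cases "k = 0"; cases "k = n - 1") auto
qed

lemma generator_matrix_carrier:
  "code_generator_matrix (cycle_graph n) \<in> carrier_mat n (2 * n)"
  by (auto simp: code_generator_matrix_def adjacency_matrix_def cycle_graph_def Let_def)

lemma generator_matrix_index:
  assumes "n \<ge> 3" "i < n" "j < 2 * n"
  shows "code_generator_matrix (cycle_graph n) $$ (i, j) =
    of_bool (if j < n then i = j else i = (j - 1) mod n \<or> i = (j + 1) mod n)"
proof (cases "j < n")
  case True
  then show ?thesis using assms
    by (simp add: code_generator_matrix_def adjacency_matrix_def cycle_graph_def Let_def)
next
  case False
  define k where "k = j - n"
  have k: "j = n + k" "k < n" using False assms by (auto simp: k_def)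
  have vs: "sorted_list_of_set (fst (cycle_graph n)) = [1..<Suc n]"
    by (simp add: cycle_graph_def atLeastLessThanSuc_atLeastAtMost flip: sorted_list_of_set_range)
  have "code_generator_matrix (cycle_graph n) $$ (i, j) = adjacency_matrix (cycle_graph n) $$ (i, k)"
    using assms k by (simp add: code_generator_matrix_def adjacency_matrix_def cycle_graph_def Let_def)
  also have "\<dots> = of_bool ({i + 1, k + 1} \<in> snd (cycle_graph n))"
    using assms k unfolding adjacency_matrix_def vs
    by (simp add: cycle_graph_def Let_def nth_upt del: upt_Suc)
  also have "\<dots> = of_bool (i = (j - 1) mod n \<or> i = (j + 1) mod n)"
    using cycle_edge_iff[OF assms(1,2) k(2)] k(1) by simp
  finally show ?thesis using False by simp
qed

text \<open>The product with the transposed generator matrix is the combination of the rows with the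
  coefficients \<open>y\<close>.\<close>

lemma generator_combination:
  assumes n: "n \<ge> 3" and y: "y \<in> carrier_vec n"
  shows "(code_generator_matrix (cycle_graph n))\<^sup>T *\<^sub>v y = codeword n {i. i < n \<and> y $ i = 1}"
proof -
  define S where "S = {i. i < n \<and> y $ i = 1}"
  have yS: "y $ i = of_bool (i \<in> S)" if "i < n" for i
    using that by (cases "y $ i") (auto simp: S_def)
  let ?M = "code_generator_matrix (cycle_graph n)"
  have "?M\<^sup>T *\<^sub>v y = codeword n S"
  proof (rule eq_vecI)
    show "dim_vec (?M\<^sup>T *\<^sub>v y) = dim_vec (codeword n S)"
      using generator_matrix_carrier[of n] by simp
    fix j assume "j < dim_vec (codeword n S)"
    then have j: "j < 2 * n" by simp
    have "(?M\<^sup>T *\<^sub>v y) $ j = (\<Sum>i<n. ?M $$ (i, j) * y $ i)"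
      using generator_matrix_carrier[of n] j y
      by (auto simp: scalar_prod_def atLeast0LessThan intro!: sum.cong)
    also have "\<dots> = codeword n S $ j"
    proof (cases "j < n")
      case True
      have "(\<Sum>i<n. ?M $$ (i, j) * y $ i) = (\<Sum>i<n. if i = j then y $ i else 0)"
        using generator_matrix_index[OF n _ j] True by (intro sum.cong) auto
      then show ?thesis using True j yS[of j] by (simp add: codeword_def)
    next
      case False
      let ?p = "(j - 1) mod n" and ?q = "(j + 1) mod n"
      \<comment> \<open>The two neighbours are distinct because \<open>n\<close> does not divide \<open>2\<close>, so the column has exactly
        two nonzero entries.\<close>
      have "?p \<noteq> ?q"
      proof
        assume "?p = ?q"
        moreover have "j + 1 = (j - 1) + 2" using False n by simp
        ultimately have "[(j - 1) + 2 = (j - 1) + 0] (mod n)" by (simp add: cong_def)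
        then have "[2 = 0] (mod n)" by (simp only: cong_add_lcancel_nat)
        then show False using n by (simp add: cong_def)
      qed
      have "(\<Sum>i<n. ?M $$ (i, j) * y $ i) = (\<Sum>i\<in>{?p, ?q}. ?M $$ (i, j) * y $ i)"
        using generator_matrix_index[OF n _ j] False n by (intro sum.mono_neutral_right) auto
      also have "\<dots> = ?M $$ (?p, j) * y $ ?p + ?M $$ (?q, j) * y $ ?q"
      proof -
        have "(\<Sum>i\<in>{?p, ?q}. f i) = f ?p + f ?q" for f :: "nat \<Rightarrow> bit"
          using \<open>?p \<noteq> ?q\<close> by simp
        then show ?thesis .
      qed
      also have "\<dots> = y $ ?p + y $ ?q"
        using generator_matrix_index[OF n _ j, of ?p] generator_matrix_index[OF n _ j, of ?q] False n
        by simp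
      also have "\<dots> = of_bool ((?p \<in> S) \<noteq> (?q \<in> S))"
        using yS[of ?p] yS[of ?q] n by auto
      finally show ?thesis using False j by (simp add: codeword_def)
    qed
    finally show "(?M\<^sup>T *\<^sub>v y) $ j = codeword n S $ j" .
  qed
  then show ?thesis by (simp only: S_def)
qed

lemma graph_code_cycle:
  assumes n: "n \<ge> 3"
  shows "graph_code (cycle_graph n) = codeword n ` {S. S \<subseteq> {..<n}}"
proof -
  let ?M = "code_generator_matrix (cycle_graph n)"
  have "graph_code (cycle_graph n) =
      {w \<in> carrier_vec (2 * n). \<exists>y \<in> carrier_vec n. ?M\<^sup>T *\<^sub>v y = w}"
    using generator_matrix_carrier[of n] vec_space.row_space_eq[of ?M n "2 * n"]
    by (simp add: graph_code_def cycle_graph_def)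
  also have "\<dots> = codeword n ` {S. S \<subseteq> {..<n}}"
  proof (intro equalityI subsetI)
    fix w assume "w \<in> {w \<in> carrier_vec (2 * n). \<exists>y \<in> carrier_vec n. ?M\<^sup>T *\<^sub>v y = w}"
    then show "w \<in> codeword n ` {S. S \<subseteq> {..<n}}"
      using generator_combination[OF n] by auto
  next
    fix w assume "w \<in> codeword n ` {S. S \<subseteq> {..<n}}"
    then obtain S where S: "S \<subseteq> {..<n}" "w = codeword n S" by auto
    define y :: "bit vec" where "y = vec n (\<lambda>i. of_bool (i \<in> S))"
    have "{i. i < n \<and> y $ i = 1} = S" using S by (auto simp: y_def)
    then have "?M\<^sup>T *\<^sub>v y = w" using generator_combination[OF n, of y] S by (simp add: y_def)
    moreover have "w \<in> carrier_vec (2 * n)" using S by (simp add: codeword_def)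
    ultimately show "w \<in> {w \<in> carrier_vec (2 * n). \<exists>y \<in> carrier_vec n. ?M\<^sup>T *\<^sub>v y = w}"
      by (auto simp: y_def)
  qed
  finally show ?thesis .
qed

text \<open>The vertex \<open>v + 1\<close> is the middle vertex of the step from \<open>v\<close> to \<open>v + 2\<close>; its entry in the second
  half records whether \<open>S\<close> cuts that step.\<close>

lemma support_codeword:
  assumes "n > 0" "S \<subseteq> {..<n}"
  shows "vec_support (codeword n S) = S \<union> (\<lambda>v. n + (v + 1) mod n) ` step_cut n S"
proof (intro equalityI subsetI)
  fix j assume j: "j \<in> vec_support (codeword n S)"
  show "j \<in> S \<union> (\<lambda>v. n + (v + 1) mod n) ` step_cut n S"
  proof (cases "j < n")
    case True
    then show ?thesis using j by (simp add: vec_support_def codeword_def)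
  next
    case False
    define v where "v = (j - 1) mod n"
    have j2: "j < 2 * n" "((j - 1) mod n \<in> S) \<noteq> ((j + 1) mod n \<in> S)"
      using False j by (auto simp: vec_support_def codeword_def split: if_splits)
    have "(v + 2) mod n = (j - 1 + 2) mod n" unfolding v_def by (rule mod_add_left_eq)
    also have "j - 1 + 2 = j + 1" using False assms by simp
    finally have "v \<in> step_cut n S" using j2 assms by (simp add: step_cut_def v_def)
    moreover have "j = n + (v + 1) mod n"
    proof -
      have "(v + 1) mod n = (j - 1 + 1) mod n" unfolding v_def by (rule mod_add_left_eq)
      also have "j - 1 + 1 = n + (j - n)" using False assms by simp
      also have "(n + (j - n)) mod n = (j - n) mod n" by (rule mod_add_self1)
      also have "(j - n) mod n = j - n" using j2 by simp
      finally show ?thesis using False by simp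
    qed
    ultimately show ?thesis by blast
  qed
next
  fix j assume "j \<in> S \<union> (\<lambda>v. n + (v + 1) mod n) ` step_cut n S"
  then show "j \<in> vec_support (codeword n S)"
  proof
    assume "j \<in> S"
    then show ?thesis using assms by (auto simp: vec_support_def codeword_def)
  next
    assume "j \<in> (\<lambda>v. n + (v + 1) mod n) ` step_cut n S"
    then obtain v where v: "v < n" "(v \<in> S) \<noteq> ((v + 2) mod n \<in> S)" "j = n + (v + 1) mod n"
      by (auto simp: step_cut_def)
    have "(j - 1) mod n = v"
    proof (cases "v + 1 = n")
      case False
      then have "j - 1 = n + v" using v by simp
      then show ?thesis using v by simp
    qed (use v in auto)
    moreover have "(j + 1) mod n = (v + 2) mod n"
    proof -
      have "(j + 1) mod n = ((v + 1) mod n + 1) mod n"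
        using mod_add_self1[of n "(v + 1) mod n + 1"] by (simp only: v(3) add.assoc)
      also have "\<dots> = (v + 1 + 1) mod n" by (rule mod_add_left_eq)
      finally show ?thesis by simp
    qed
    ultimately show ?thesis
      using v assms by (simp add: vec_support_def codeword_def)
  qed
qed

lemma support_codeword_subset_iff:
  assumes n: "n > 0" and T: "T \<subseteq> {..<n}" and S: "S \<subseteq> {..<n}"
  shows "vec_support (codeword n T) \<subseteq> vec_support (codeword n S) \<longleftrightarrow>
    T \<subseteq> S \<and> step_cut n T \<subseteq> step_cut n S"
proof -
  let ?e = "\<lambda>v. n + (v + 1) mod n"
  have inj: "inj_on ?e {..<n}"
  proof (rule inj_onI)
    fix v w assume vw: "v \<in> {..<n}" "w \<in> {..<n}" "?e v = ?e w"
    then have "[v + 1 = w + 1] (mod n)" by (simp add: cong_def)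
    then have "[v = w] (mod n)" by (simp only: cong_add_rcancel_nat)
    then show "v = w" using vw by (simp add: cong_def)
  qed
  have cut: "step_cut n A \<subseteq> {..<n}" for A by (auto simp: step_cut_def)
  have "T \<union> ?e ` step_cut n T \<subseteq> S \<union> ?e ` step_cut n S \<longleftrightarrow>
      T \<subseteq> S \<and> ?e ` step_cut n T \<subseteq> ?e ` step_cut n S"
  proof -
    have "T \<inter> ?e ` step_cut n S = {}" "S \<inter> ?e ` step_cut n T = {}" using T S by auto
    then show ?thesis by blast
  qed
  also have "?e ` step_cut n T \<subseteq> ?e ` step_cut n S \<longleftrightarrow> step_cut n T \<subseteq> step_cut n S"
  proof (intro iffI subsetI)
    fix v assume sub: "?e ` step_cut n T \<subseteq> ?e ` step_cut n S" and v: "v \<in> step_cut n T"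
    then have "?e v \<in> ?e ` step_cut n S" by blast
    then show "v \<in> step_cut n S" using inj_on_image_mem_iff[OF inj _ cut] v cut by blast
  qed blast
  finally show ?thesis by (simp only: support_codeword[OF n T] support_codeword[OF n S])
qed

lemma codeword_inj:
  assumes "S \<subseteq> {..<n}" "T \<subseteq> {..<n}" "codeword n S = codeword n T"
  shows "S = T"
proof -
  have "A = {j. j < n \<and> codeword n A $ j = 1}" if "A \<subseteq> {..<n}" for A
    using that by (auto simp: codeword_def)
  from this[OF assms(1)] this[OF assms(2)] assms(3) show ?thesis by simp
qed

lemma codeword_eq_0_iff:
  assumes "S \<subseteq> {..<n}"
  shows "codeword n S = 0\<^sub>v (2 * n) \<longleftrightarrow> S = {}"
proof -
  have "codeword n {} = 0\<^sub>v (2 * n)" by (intro eq_vecI) (auto simp: codeword_def)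
  then show ?thesis using codeword_inj[OF assms, of "{}"] by auto
qed

lemma minimal_codeword_iff:
  assumes n: "n \<ge> 3" and S: "S \<subseteq> {..<n}"
  shows "minimal_codeword (graph_code (cycle_graph n)) (codeword n S) \<longleftrightarrow> step_connected n S"
proof -
  have psub: "vec_support (codeword n T) \<subset> vec_support (codeword n S) \<longleftrightarrow>
      T \<subseteq> S \<and> step_cut n T \<subseteq> step_cut n S \<and> T \<noteq> S" if T: "T \<subseteq> {..<n}" for T
    using support_codeword_subset_iff[of n T S] support_codeword_subset_iff[of n S T] n S T
    unfolding less_le_not_le by auto
  have "minimal_codeword (graph_code (cycle_graph n)) (codeword n S) \<longleftrightarrow>
      S \<noteq> {} \<and> \<not> (\<exists>T \<subseteq> {..<n}. T \<noteq> {} \<and> T \<subseteq> S \<and> step_cut n T \<subseteq> step_cut n S \<and> T \<noteq> S)"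
    using S psub codeword_eq_0_iff
    unfolding minimal_codeword_def graph_code_cycle[OF n] by auto
  also have "\<dots> \<longleftrightarrow> step_connected n S"
    using S unfolding step_connected_def by blast
  finally show ?thesis .
qed

section \<open>Counting the minimal codewords\<close>

lemma num_minimal_codewords_cycle:
  assumes n: "n \<ge> 3"
  shows "num_minimal_codewords (cycle_graph n) = card {S. step_connected n S}"
proof -
  have sub: "S \<subseteq> {..<n}" if "step_connected n S" for S
    using that by (simp add: step_connected_def)
  have "{c. minimal_codeword (graph_code (cycle_graph n)) c} = codeword n ` {S. step_connected n S}"
  proof (intro equalityI subsetI)
    fix c assume c: "c \<in> {c. minimal_codeword (graph_code (cycle_graph n)) c}"
    then have "c \<in> codeword n ` {S. S \<subseteq> {..<n}}"
      by (simp add: minimal_codeword_def graph_code_cycle[OF n])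
    then obtain S where S: "S \<subseteq> {..<n}" "c = codeword n S" by auto
    then have "step_connected n S" using c minimal_codeword_iff[OF n S(1)] by simp
    then show "c \<in> codeword n ` {S. step_connected n S}" using S(2) by simp
  next
    fix c assume "c \<in> codeword n ` {S. step_connected n S}"
    then show "c \<in> {c. minimal_codeword (graph_code (cycle_graph n)) c}"
      using minimal_codeword_iff[OF n] sub by auto
  qed
  moreover have "inj_on (codeword n) {S. step_connected n S}"
    using sub codeword_inj by (intro inj_onI) blast
  ultimately show ?thesis by (simp add: num_minimal_codewords_def card_image)
qed

theorem proposition3p7:
  fixes n :: nat
  assumes "n \<ge> 3"
  shows "real (num_minimal_codewords (cycle_graph n)) =
    (if n mod 2 = 0 then (real n ^ 2 - 2 * real n + 4) / 2
     else real n ^ 2 - real n + 1)"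
proof (cases "even n")
  case True
  then obtain m where m: "n = 2 * m" by blast
  then have "num_minimal_codewords (cycle_graph n) = 2 * m * (m - 1) + 2" "m \<ge> 1"
    using assms by (simp_all add: num_minimal_codewords_cycle card_step_connected period_def)
  then show ?thesis
    using m by (simp add: of_nat_diff power2_eq_square field_simps)
next
  case False
  then have "num_minimal_codewords (cycle_graph n) = n * (n - 1) + 1"
    using assms by (simp add: num_minimal_codewords_cycle card_step_connected period_def)
  then show ?thesis
    using assms False by (simp add: of_nat_diff power2_eq_square field_simps flip: even_iff_mod_2_eq_zero)
qed

end
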